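(* Let $K$ be a field, $q\ge2$ an integer, and $y\in K^{\mathbb{N}_0}$ a $q$-regular sequence. Let $x\in K^{\mathcal{A}_q^\star}$ be the recognisable series associated to $y$, and let $(u,M,w)$ be a minimal linear representation of the recognisable series $x$. Then $(u,M,w)$ is a minimal linear representation of the $q$-regular sequence $y$.
   Context: $\mathcal{A}_q=\{0,\ldots,q-1\}$ and $\mathcal{A}_q^\star$ is the set of finite words over $\mathcal{A}_q$ (including the empty word). For $b=a_0\ldots a_\ell\in\mathcal{A}_q^\star$, $\operatorname{val}(b)=\sum_{j=0}^{\ell}a_jq^j$, with $\operatorname{val}$ of the empty word equal to $0$. For a finite set $\mathcal{A}$, a family $M=(M(a))_{a\in\mathcal{A}}$ of $D\times D$ matrices over $K$ and a word $b=a_0\ldots a_\ell\in\mathcal{A}^\star$, $M(b)=M(a_0)M(a_1)\cdots M(a_\ell)$, and $M$ of the empty word is the $D\times D$ identity matrix; if $D=0$, products of an empty row vector, $M(b)$ and an empty column vector are $0$. Recognisable series: $x\in K^{\mathcal{A}^\star}$ is recognisable if there are $D\in\mathbb{N}_0$, a family $M=(M(a))_{a\in\mathcal{A}}$ of $D\times D$ matrices over $K$, and $u\in K^{1\times D}$, $w\in K^{D\times1}$ with $x(b)=uM(b)w$ for all $b\in\mathcal{A}^\star$; $(u,M,w)$ is then a linear representation of $x$ of dimension $D$, and it is minimal if its dimension is minimal among all linear representations of $x$. $q$-regular sequences: $y\in K^{\mathbb{N}_0}$ is $q$-regular if there are $D\in\mathbb{N}_0$, a family $M=(M(a))_{a\in\mathcal{A}_q}$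 of $D\times D$ matrices over $K$, a sequence $v\in(K^{D\times1})^{\mathbb{N}_0}$ and $u\in K^{1\times D}$ such that $y(n)=uv(n)$ for all $n\in\mathbb{N}_0$ and $v(qn+r)=M(r)v(n)$ for all $r\in\mathcal{A}_q$, $n\in\mathbb{N}_0$; then $(u,M,v(0))$ is a linear representation of $y$ of dimension $D$, and it is minimal if its dimension is minimal among all linear representations of $y$. The recognisable series associated to a $q$-regular sequence $y$ is the series $x\in K^{\mathcal{A}_q^\star}$ defined by $x(b)=u'M'(b)w'$ for all $b\in\mathcal{A}_q^\star$, where $(u',M',w')$ is any linear representation of $y$ (this does not depend on the choice of linear representation; in fact $x(b)=y(\operatorname{val}(b))$). *)

theory Defs
  imports "Jordan_Normal_Form.Matrix"
begin

abbreviation digits :: "nat \<Rightarrow> nat set" where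
  "digits q \<equiv> {0..<q}"

text \<open>Least significant digit first.\<close>

definition word_val :: "nat \<Rightarrow> nat list \<Rightarrow> nat" where
  "word_val q b = (\<Sum>j<length b. b ! j * q ^ j)"

text \<open>The dimension \<open>D\<close> is an argument because it is needed for the empty word.\<close>

primrec word_mat :: "nat \<Rightarrow> ('b \<Rightarrow> 'k::semiring_1 mat) \<Rightarrow> 'b list \<Rightarrow> 'k mat" where
  "word_mat D M [] = 1\<^sub>m D"
| "word_mat D M (a # b) = M a * word_mat D M b"

text \<open>Series over an alphabet \<open>A\<close> are functions on all lists of which only the values on
  \<open>lists A\<close> matter; likewise only the matrices \<open>M a\<close> with \<open>a \<in> A\<close> matter. The row vector \<open>u\<close>
  and the column vector \<open>w\<close> both have type \<open>vec\<close>, so \<open>u M(b) w\<close> is a scalar product, which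
  is \<open>0\<close> for \<open>D = 0\<close>.\<close>

definition series_lin_rep ::
  "'b set \<Rightarrow> ('b list \<Rightarrow> 'k::field) \<Rightarrow> nat \<Rightarrow> 'k vec \<Rightarrow> ('b \<Rightarrow> 'k mat) \<Rightarrow> 'k vec \<Rightarrow> bool" where
  "series_lin_rep A x D u M w \<longleftrightarrow>
     u \<in> carrier_vec D \<and> (\<forall>a\<in>A. M a \<in> carrier_mat D D) \<and> w \<in> carrier_vec D \<and>
     (\<forall>b\<in>lists A. x b = u \<bullet> (word_mat D M b *\<^sub>v w))"

definition minimal_series_lin_rep ::
  "'b set \<Rightarrow> ('b list \<Rightarrow> 'k::field) \<Rightarrow> nat \<Rightarrow> 'k vec \<Rightarrow> ('b \<Rightarrow> 'k mat) \<Rightarrow> 'k vec \<Rightarrow> bool" where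
  "minimal_series_lin_rep A x D u M w \<longleftrightarrow>
     series_lin_rep A x D u M w \<and>
     (\<forall>D' u' M' w'. series_lin_rep A x D' u' M' w' \<longrightarrow> D \<le> D')"

definition regular_lin_rep ::
  "nat \<Rightarrow> (nat \<Rightarrow> 'k::field) \<Rightarrow> nat \<Rightarrow> 'k vec \<Rightarrow> (nat \<Rightarrow> 'k mat) \<Rightarrow> 'k vec \<Rightarrow> bool" where
  "regular_lin_rep q y D u M w \<longleftrightarrow>
     u \<in> carrier_vec D \<and> (\<forall>r\<in>digits q. M r \<in> carrier_mat D D) \<and>
     (\<exists>v. (\<forall>n. v n \<in> carrier_vec D) \<and> v 0 = w \<and>
          (\<forall>n. y n = u \<bullet> v n) \<and>
          (\<forall>r\<in>digits q. \<forall>n. v (q * n + r) = M r *\<^sub>v v n))"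

definition minimal_regular_lin_rep ::
  "nat \<Rightarrow> (nat \<Rightarrow> 'k::field) \<Rightarrow> nat \<Rightarrow> 'k vec \<Rightarrow> (nat \<Rightarrow> 'k mat) \<Rightarrow> 'k vec \<Rightarrow> bool" where
  "minimal_regular_lin_rep q y D u M w \<longleftrightarrow>
     regular_lin_rep q y D u M w \<and>
     (\<forall>D' u' M' w'. regular_lin_rep q y D' u' M' w' \<longrightarrow> D \<le> D')"

definition q_regular :: "nat \<Rightarrow> (nat \<Rightarrow> 'k::field) \<Rightarrow> bool" where
  "q_regular q y \<longleftrightarrow> (\<exists>D u M w. regular_lin_rep q y D u M w)"

text \<open>A series is associated to \<open>y\<close> if it is given by some linear representation of \<open>y\<close>. By
  \<open>associated_series_eq\<close> below the choice of the representation is irrelevant.\<close>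

definition associated_series :: "nat \<Rightarrow> (nat \<Rightarrow> 'k::field) \<Rightarrow> (nat list \<Rightarrow> 'k) \<Rightarrow> bool" where
  "associated_series q y x \<longleftrightarrow>
     (\<exists>D u M w. regular_lin_rep q y D u M w \<and>
        (\<forall>b\<in>lists (digits q). x b = u \<bullet> (word_mat D M b *\<^sub>v w)))"

lemma word_val_Nil [simp]: "word_val q [] = 0"
  by (simp add: word_val_def)

lemma word_val_Cons [simp]: "word_val q (a # b) = q * word_val q b + a"
  by (simp add: word_val_def sum.lessThan_Suc_shift sum_distrib_left algebra_simps
           del: sum.lessThan_Suc)

lemma word_mat_carrier:
  assumes "\<forall>a\<in>A. M a \<in> carrier_mat D D" "b \<in> lists A"
  shows "word_mat D M b \<in> carrier_mat D D"
  using assms(2)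
proof (induction b)
  case (Cons a b)
  then show ?case using assms(1) by (auto intro!: mult_carrier_mat)
qed simp

lemma regular_lin_rep_word:
  assumes "regular_lin_rep q y D u M w" "b \<in> lists (digits q)"
  shows "u \<bullet> (word_mat D M b *\<^sub>v w) = y (word_val q b)"
proof -
  from assms(1) obtain v where M: "\<forall>r\<in>digits q. M r \<in> carrier_mat D D"
    and v: "\<And>n. v n \<in> carrier_vec D" "v 0 = w" "\<And>n. y n = u \<bullet> v n"
      "\<And>r n. r \<in> digits q \<Longrightarrow> v (q * n + r) = M r *\<^sub>v v n"
    unfolding regular_lin_rep_def by blast
  have w: "w \<in> carrier_vec D" using v(1)[of 0] v(2) by simp
  have "word_mat D M b *\<^sub>v w = v (word_val q b)"
    using assms(2)
  proof (induction b)
    case Nil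
    then show ?case using w v(2) by simp
  next
    case (Cons a b)
    have "word_mat D M (a # b) *\<^sub>v w = M a *\<^sub>v (word_mat D M b *\<^sub>v w)"
      using assoc_mult_mat_vec[OF _ word_mat_carrier[OF M Cons.hyps(2)] w, of "M a" D]
        M Cons.hyps(1) by simp
    also have "\<dots> = v (word_val q (a # b))"
      using Cons v(4) by simp
    finally show ?case .
  qed
  then show ?thesis using v(3) by simp
qed

lemma associated_series_eq:
  assumes "associated_series q y x" "regular_lin_rep q y D u M w" "b \<in> lists (digits q)"
  shows "x b = u \<bullet> (word_mat D M b *\<^sub>v w)" and "x b = y (word_val q b)"
  using assms regular_lin_rep_word unfolding associated_series_def by metis+

end

theory Submission
  imports Defs
begin

text \<open>A minimal representation of a series is observable: a column vector annihilated by every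
  row vector \<open>u M(c)\<close> is zero, since otherwise the state space could be projected along it onto
  a space of smaller dimension. Now \<open>u M(c) M(b) w = x (c @ b) = y (val (c @ b))\<close>, and
  \<open>val (c @ b)\<close> depends on \<open>b\<close> only through \<open>val b\<close>. By observability \<open>M(b) w\<close> is a function
  \<open>v\<close> of \<open>val b\<close>, and this \<open>v\<close> satisfies the recurrences of a regular sequence.\<close>

lemma word_mat_Cons_mult_vec:
  assumes "\<forall>a\<in>A. M a \<in> carrier_mat D D" "a \<in> A" "b \<in> lists A" "w \<in> carrier_vec D"
  shows "word_mat D M (a # b) *\<^sub>v w = M a *\<^sub>v (word_mat D M b *\<^sub>v w)"
  using assms assoc_mult_mat_vec[OF _ word_mat_carrier[OF assms(1,3)] assms(4), of "M a" D]
  by simp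

lemma word_mat_mult_vec_carrier:
  assumes "\<forall>a\<in>A. M a \<in> carrier_mat D D" "b \<in> lists A" "w \<in> carrier_vec D"
  shows "word_mat D M b *\<^sub>v w \<in> carrier_vec D"
  using mult_mat_vec_carrier[OF word_mat_carrier[OF assms(1,2)] assms(3)] .

lemma word_mat_append_mult_vec:
  assumes M: "\<forall>a\<in>A. M a \<in> carrier_mat D D" and "c \<in> lists A"
    and b: "b \<in> lists A" and w: "w \<in> carrier_vec D"
  shows "word_mat D M (c @ b) *\<^sub>v w = word_mat D M c *\<^sub>v (word_mat D M b *\<^sub>v w)"
  using assms(2)
proof (induction c)
  case Nil
  then show ?case using word_mat_mult_vec_carrier[OF M b w] by simp
next
  case (Cons a c)
  have "word_mat D M (a # c @ b) *\<^sub>v w = M a *\<^sub>v (word_mat D M (c @ b) *\<^sub>v w)"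
    using Cons.hyps b by (intro word_mat_Cons_mult_vec[OF M _ _ w]) auto
  also have "\<dots> = word_mat D M (a # c) *\<^sub>v (word_mat D M b *\<^sub>v w)"
    using Cons word_mat_Cons_mult_vec[OF M _ _ word_mat_mult_vec_carrier[OF M b w]] by simp
  finally show ?case by simp
qed

text \<open>Subtracting the multiple of \<open>z\<close> that clears coordinate \<open>k\<close>
  maps onto the hyperplane of vectors vanishing at \<open>k\<close>, which has dimension
  \<open>d\<close>. So \<open>P\<close> clears that coordinate and drops it, and \<open>Q\<close>
  reinserts a zero.\<close>

lemma projection_along_vec_factorises:
  fixes z :: "'k::field vec"
  assumes z: "z \<in> carrier_vec (Suc d)" and k: "k < Suc d" "z $ k \<noteq> 0"
  obtains P Q where "P \<in> carrier_mat d (Suc d)" "Q \<in> carrier_mat (Suc d) d"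
    "\<And>s. s \<in> carrier_vec (Suc d) \<Longrightarrow> Q *\<^sub>v (P *\<^sub>v s) = s - (s $ k / z $ k) \<cdot>\<^sub>v z"
proof
  \<comment> \<open>The increasing bijection from the indices below \<open>d\<close> to those below
    \<open>Suc d\<close> other than \<open>k\<close>.\<close>
  define skip where "skip j = (if j < k then j else Suc j)" for j
  define P where "P = mat d (Suc d)
    (\<lambda>(j, i). (if i = skip j then 1 else 0) - (if i = k then z $ skip j / z $ k else 0))"
  define Q where "Q = mat (Suc d) d (\<lambda>(i, j). if skip j = i then 1 else (0 :: 'k))"
  show "P \<in> carrier_mat d (Suc d)" "Q \<in> carrier_mat (Suc d) d"
    by (simp_all add: P_def Q_def)
  fix s :: "'k vec" assume s: "s \<in> carrier_vec (Suc d)"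
  have skip: "skip j < Suc d" if "j < d" for j
    using that by (auto simp: skip_def)
  have Ps: "(P *\<^sub>v s) $ j = s $ skip j - s $ k / z $ k * z $ skip j" if j: "j < d" for j
  proof -
    have "(P *\<^sub>v s) $ j = (\<Sum>i = 0..<Suc d.
        (if i = skip j then s $ i else 0) - (if i = k then z $ skip j / z $ k * s $ i else 0))"
      using j s by (auto simp: P_def scalar_prod_def simp del: sum.op_ivl_Suc
          intro!: sum.cong simp: algebra_simps)
    also have "\<dots> = s $ skip j - z $ skip j / z $ k * s $ k"
      using k(1) skip[OF j] by (simp add: sum_subtractf del: sum.op_ivl_Suc)
    finally show ?thesis by simp
  qed
  have PsC: "dim_vec (P *\<^sub>v s) = d" by (simp add: P_def)
  show "Q *\<^sub>v (P *\<^sub>v s) = s - (s $ k / z $ k) \<cdot>\<^sub>v z"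
  proof (rule eq_vecI)
    show "dim_vec (Q *\<^sub>v (P *\<^sub>v s)) = dim_vec (s - (s $ k / z $ k) \<cdot>\<^sub>v z)"
      using z by (simp add: Q_def)
    fix i assume "i < dim_vec (s - (s $ k / z $ k) \<cdot>\<^sub>v z)"
    then have i: "i < Suc d" using z by simp
    have QPs: "(Q *\<^sub>v (P *\<^sub>v s)) $ i
        = (\<Sum>j = 0..<d. if skip j = i then (P *\<^sub>v s) $ j else 0)"
      using i PsC by (auto simp: Q_def scalar_prod_def intro!: sum.cong)
    show "(Q *\<^sub>v (P *\<^sub>v s)) $ i = (s - (s $ k / z $ k) \<cdot>\<^sub>v z) $ i"
    proof (cases "i = k")
      case True
      then have "skip j \<noteq> i" for j by (simp add: skip_def)
      then show ?thesis using QPs True z s k by simp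
    next
      case False
      \<comment> \<open>The preimage of \<open>i\<close> under \<open>skip\<close>; since
        \<open>i\<close> differs from \<open>k\<close>, the subtraction is only reached for
        \<open>i\<close> above \<open>k\<close> and does not truncate.\<close>
      define l where "l = (if i < k then i else i - 1)"
      have l: "l < d" "skip l = i" using False i k(1) by (auto simp: l_def skip_def)
      have "skip j = i \<longleftrightarrow> j = l" for j
        using False by (auto simp: l_def skip_def split: if_splits)
      then show ?thesis using QPs Ps[OF l(1)] l z s i by simp
    qed
  qed
qed

text \<open>If \<open>z\<close> were nonzero, compressing the matrices with \<open>P\<close> and
  \<open>Q\<close> would give a representation of the same series of dimension
  \<open>D - 1\<close>.\<close>

lemma minimal_series_lin_rep_observable:
  fixes x :: "'b list \<Rightarrow> 'k::field"
  assumes min: "minimal_series_lin_rep A x D u M w" and z: "z \<in> carrier_vec D"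
    and unobs: "\<And>c. c \<in> lists A \<Longrightarrow> u \<bullet> (word_mat D M c *\<^sub>v z) = 0"
  shows "z = 0\<^sub>v D"
proof (rule ccontr)
  assume "z \<noteq> 0\<^sub>v D"
  then obtain k where k: "k < D" "z $ k \<noteq> 0" using z by (metis carrier_vecD eq_vecI index_zero_vec)
  then obtain d where D: "D = Suc d" by (metis less_imp_Suc_add)
  from min have u: "u \<in> carrier_vec D" and M: "\<forall>a\<in>A. M a \<in> carrier_mat D D"
    and w: "w \<in> carrier_vec D"
    and x: "\<And>b. b \<in> lists A \<Longrightarrow> x b = u \<bullet> (word_mat D M b *\<^sub>v w)"
    by (auto simp: minimal_series_lin_rep_def series_lin_rep_def)
  obtain P Q where P: "P \<in> carrier_mat d D" and Q: "Q \<in> carrier_mat D d"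
    and QP: "\<And>s. s \<in> carrier_vec D \<Longrightarrow> Q *\<^sub>v (P *\<^sub>v s) = s - (s $ k / z $ k) \<cdot>\<^sub>v z"
    using projection_along_vec_factorises z k unfolding D by blast
  define M' where "M' a = P * (M a * Q)" for a
  have M': "\<forall>a\<in>A. M' a \<in> carrier_mat d d"
    using M P Q by (auto simp: M'_def)
  have w': "P *\<^sub>v w \<in> carrier_vec d" using P w by simp
  \<comment> \<open>The line spanned by \<open>z\<close> need not be invariant under the matrices
    \<open>M a\<close>, so full and compressed states are compared only through row vectors that
    annihilate every \<open>M(c) z\<close>; \<open>u\<close> is one of them.\<close>
  define R where
    "R = {r \<in> carrier_vec D. \<forall>c\<in>lists A. r \<bullet> (word_mat D M c *\<^sub>v z) = 0}"
  \<comment> \<open>The empty word in the definition of \<open>R\<close> gives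
    \<open>r \<bullet> z = 0\<close>, so \<open>r\<close> does not see the multiple of
    \<open>z\<close> that is subtracted.\<close>
  have QP_R: "r \<bullet> (Q *\<^sub>v (P *\<^sub>v s)) = r \<bullet> s" if "r \<in> R" and s: "s \<in> carrier_vec D" for r s
  proof -
    from that have r: "r \<in> carrier_vec D" and "\<forall>c\<in>lists A. r \<bullet> (word_mat D M c *\<^sub>v z) = 0"
      by (auto simp: R_def)
    then have "r \<bullet> z = 0" using z by (metis lists.Nil one_mult_mat_vec word_mat.simps(1))
    then show ?thesis using r s z by (simp add: QP scalar_prod_minus_distrib[of _ D])
  qed
  \<comment> \<open>As a row vector this is \<open>r M(a)\<close>, and
    \<open>r M(a) M(c) z = r M(ac) z\<close>.\<close>
  have R_closed: "(M a)\<^sup>T *\<^sub>v r \<in> R" if "r \<in> R" "a \<in> A" for r a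
  proof -
    have "((M a)\<^sup>T *\<^sub>v r) \<bullet> (word_mat D M c *\<^sub>v z) = 0" if c: "c \<in> lists A" for c
    proof -
      have "((M a)\<^sup>T *\<^sub>v r) \<bullet> (word_mat D M c *\<^sub>v z) = r \<bullet> (word_mat D M (a # c) *\<^sub>v z)"
        using \<open>r \<in> R\<close> \<open>a \<in> A\<close> M word_mat_mult_vec_carrier[OF M c z]
          word_mat_Cons_mult_vec[OF M \<open>a \<in> A\<close> c z]
        by (simp add: transpose_vec_mult_scalar[of _ D D] R_def)
      also have "\<dots> = 0"
        using \<open>r \<in> R\<close> \<open>a \<in> A\<close> c by (simp add: R_def del: word_mat.simps)
      finally show ?thesis .
    qed
    moreover have "(M a)\<^sup>T *\<^sub>v r \<in> carrier_vec D"
      using that M by (auto simp: R_def intro!: mult_mat_vec_carrier)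
    ultimately show ?thesis by (simp add: R_def)
  qed
  \<comment> \<open>The row vector \<open>r\<close> must vary in the induction: the first letter
    \<open>a\<close> is moved to the row side, replacing \<open>r\<close> by \<open>r M(a)\<close>,
    which stays in \<open>R\<close>.\<close>
  have reduced: "r \<bullet> (Q *\<^sub>v (word_mat d M' b *\<^sub>v (P *\<^sub>v w))) = r \<bullet> (word_mat D M b *\<^sub>v w)"
    if "b \<in> lists A" "r \<in> R" for b r
    using that
  proof (induction b arbitrary: r)
    case Nil
    then show ?case using QP_R w w' by simp
  next
    case (Cons a b)
    define t where "t = word_mat d M' b *\<^sub>v (P *\<^sub>v w)"
    have t: "t \<in> carrier_vec d"
      unfolding t_def by (rule word_mat_mult_vec_carrier[OF M' Cons.hyps(2) w'])
    have Ma: "M a \<in> carrier_mat D D" using M Cons.hyps(1) by blast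
    have r: "r \<in> carrier_vec D" using Cons.prems by (simp add: R_def)
    have "r \<bullet> (Q *\<^sub>v (word_mat d M' (a # b) *\<^sub>v (P *\<^sub>v w))) = r \<bullet> (Q *\<^sub>v (M' a *\<^sub>v t))"
      using word_mat_Cons_mult_vec[OF M' Cons.hyps(1,2) w'] by (simp add: t_def)
    also have "M' a *\<^sub>v t = P *\<^sub>v (M a *\<^sub>v (Q *\<^sub>v t))"
      using P Q Ma t
      by (simp add: M'_def assoc_mult_mat_vec[of _ d D _ d] assoc_mult_mat_vec[of _ D D _ d])
    also have "r \<bullet> (Q *\<^sub>v \<dots>) = r \<bullet> (M a *\<^sub>v (Q *\<^sub>v t))"
      using Ma Q t by (intro QP_R[OF Cons.prems]) auto
    also have "\<dots> = ((M a)\<^sup>T *\<^sub>v r) \<bullet> (Q *\<^sub>v t)"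
      using Ma Q t r by (simp add: transpose_vec_mult_scalar[of _ D D])
    also have "\<dots> = ((M a)\<^sup>T *\<^sub>v r) \<bullet> (word_mat D M b *\<^sub>v w)"
      unfolding t_def using R_closed[OF Cons.prems Cons.hyps(1)] by (rule Cons.IH)
    also have "\<dots> = r \<bullet> (word_mat D M (a # b) *\<^sub>v w)"
      using Ma r word_mat_mult_vec_carrier[OF M Cons.hyps(2) w]
        word_mat_Cons_mult_vec[OF M Cons.hyps(1,2) w]
      by (simp add: transpose_vec_mult_scalar[of _ D D])
    finally show ?case .
  qed
  \<comment> \<open>The vector \<open>Q\<^sup>T *\<^sub>v u\<close> encodes the row vector
    \<open>u Q\<close>; this representation has dimension one less than the minimal one.\<close>
  have "series_lin_rep A x d (Q\<^sup>T *\<^sub>v u) M' (P *\<^sub>v w)"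
    unfolding series_lin_rep_def
  proof (intro conjI ballI)
    fix b assume b: "b \<in> lists A"
    have "u \<in> R" using u unobs by (simp add: R_def)
    then have "x b = u \<bullet> (Q *\<^sub>v (word_mat d M' b *\<^sub>v (P *\<^sub>v w)))"
      using x[OF b] reduced[OF b] by simp
    then show "x b = (Q\<^sup>T *\<^sub>v u) \<bullet> (word_mat d M' b *\<^sub>v (P *\<^sub>v w))"
      using Q u word_mat_mult_vec_carrier[OF M' b w']
      by (simp add: transpose_vec_mult_scalar[of _ D d])
  qed (use M' w' Q u in auto)
  then have "D \<le> d" using min unfolding minimal_series_lin_rep_def by blast
  then show False using D by simp
qed

lemma ex_word_val:
  assumes "q \<ge> 2"
  shows "\<exists>b\<in>lists (digits q). word_val q b = n"
proof (induction n rule: less_induct)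
  case (less n)
  show ?case
  proof (cases "n = 0")
    case True
    then show ?thesis by (intro bexI[of _ "[]"]) simp_all
  next
    case False
    \<comment> \<open>Here \<open>n div q\<close> is smaller than \<open>n\<close> because
      \<open>n\<close> is nonzero and \<open>q\<close> is at least 2; the last digit
      \<open>n mod q\<close> goes in front, as words start with the least significant digit.\<close>
    then obtain b where "b \<in> lists (digits q)" "word_val q b = n div q"
      using less[of "n div q"] assms by auto
    then show ?thesis using assms by (intro bexI[of _ "n mod q # b"]) simp_all
  qed
qed

lemma word_val_append_cong:
  "word_val q b = word_val q b' \<Longrightarrow> word_val q (c @ b) = word_val q (c @ b')"
  by (induction c) simp_all

text \<open>Carries minimality over: every representation of \<open>y\<close> competes among those
  of \<open>x\<close>, so its dimension is at least the minimal one for \<open>x\<close>.\<close>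

lemma regular_lin_rep_imp_series_lin_rep:
  assumes "associated_series q y x" "regular_lin_rep q y D u M w"
  shows "series_lin_rep (digits q) x D u M w"
  using assms(2) associated_series_eq(1)[OF assms]
  unfolding regular_lin_rep_def series_lin_rep_def by auto

lemma minimal_series_lin_rep_imp_regular_lin_rep:
  assumes q: "q \<ge> 2" and assoc: "associated_series q y x"
    and min: "minimal_series_lin_rep (digits q) x D u M w"
  shows "regular_lin_rep q y D u M w"
proof -
  from min have u: "u \<in> carrier_vec D" and M: "\<forall>a\<in>digits q. M a \<in> carrier_mat D D"
    and w: "w \<in> carrier_vec D"
    and x: "\<And>b. b \<in> lists (digits q) \<Longrightarrow> x b = u \<bullet> (word_mat D M b *\<^sub>v w)"
    by (auto simp: minimal_series_lin_rep_def series_lin_rep_def)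
  have xy: "x b = y (word_val q b)" if "b \<in> lists (digits q)" for b
    using assoc associated_series_eq(2) that unfolding associated_series_def by metis
  define state where "state b = word_mat D M b *\<^sub>v w" for b
  have state: "state b \<in> carrier_vec D" if "b \<in> lists (digits q)" for b
    unfolding state_def by (rule word_mat_mult_vec_carrier[OF M that w])
  \<comment> \<open>Both states yield the same output after every prefix \<open>c\<close>, so their
    difference is unobservable and vanishes. This covers words differing by trailing zeros.\<close>
  have state_cong: "state b = state b'"
    if b: "b \<in> lists (digits q)" and b': "b' \<in> lists (digits q)"
      and eq: "word_val q b = word_val q b'" for b b'
  proof -
    have "state b - state b' = 0\<^sub>v D"
    proof (rule minimal_series_lin_rep_observable[OF min])
      fix c assume c: "c \<in> lists (digits q)"
      have ux: "u \<bullet> (word_mat D M c *\<^sub>v state e) = x (c @ e)" if "e \<in> lists (digits q)" for e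
        using c that word_mat_append_mult_vec[OF M c that w] x[of "c @ e"]
        by (simp add: state_def)
      have "x (c @ b) = x (c @ b')"
        using word_val_append_cong[OF eq, of c] xy c b b' by simp
      then have "u \<bullet> (word_mat D M c *\<^sub>v state b) = u \<bullet> (word_mat D M c *\<^sub>v state b')"
        using ux b b' by simp
      then show "u \<bullet> (word_mat D M c *\<^sub>v (state b - state b')) = 0"
        using u state[OF b] state[OF b'] word_mat_carrier[OF M c]
        by (simp add: mult_minus_distrib_mat_vec[of _ D D] scalar_prod_minus_distrib[of _ D])
    qed (use state b b' in simp)
    show ?thesis
    proof (rule eq_vecI)
      fix i assume "i < dim_vec (state b')"
      then have i: "i < D" using state[OF b'] by simp
      then have "(state b - state b') $ i = 0" using \<open>state b - state b' = 0\<^sub>v D\<close> by simp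
      then show "state b $ i = state b' $ i" using i state[OF b'] by simp
    qed (use state[OF b] state[OF b'] in simp)
  qed
  \<comment> \<open>An arbitrary word for each value; by \<open>state_cong\<close> the choice does
    not affect the state. In particular \<open>rep 0\<close> need not be the empty word.\<close>
  obtain rep where rep: "\<And>n. rep n \<in> lists (digits q)" "\<And>n. word_val q (rep n) = n"
    using ex_word_val[OF q] by metis
  have "state (rep 0) = w"
    using state_cong[of "rep 0" "[]"] rep[of 0] w by (simp add: state_def)
  moreover have "y n = u \<bullet> state (rep n)" for n
    using x[OF rep(1)] xy[OF rep(1)] rep(2) by (simp add: state_def)
  moreover have "state (rep (q * n + r)) = M r *\<^sub>v state (rep n)" if r: "r \<in> digits q" for r n
  proof -
    \<comment> \<open>The words \<open>rep (q * n + r)\<close> and \<open>r # rep n\<close> may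
      differ but have the same value, and prepending \<open>r\<close> multiplies the state by
      \<open>M r\<close>.\<close>
    have "state (rep (q * n + r)) = state (r # rep n)"
      by (rule state_cong) (use rep r in auto)
    then show ?thesis using word_mat_Cons_mult_vec[OF M r rep(1) w] by (simp add: state_def)
  qed
  ultimately show ?thesis
    unfolding regular_lin_rep_def using u M state rep(1)
    by (intro conjI exI[of _ "\<lambda>n. state (rep n)"]) auto
qed

theorem theorem4p6:
  fixes q :: nat
    and y :: "nat \<Rightarrow> 'k::field"
    and x :: "nat list \<Rightarrow> 'k"
    and D :: nat
    and u w :: "'k vec"
    and M :: "nat \<Rightarrow> 'k mat"
  assumes "q \<ge> 2"
    and "q_regular q y"
    and "associated_series q y x"
    and "minimal_series_lin_rep (digits q) x D u M w"
  shows "minimal_regular_lin_rep q y D u M w"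
  using minimal_series_lin_rep_imp_regular_lin_rep[OF assms(1,3,4)]
    regular_lin_rep_imp_series_lin_rep[OF assms(3)] assms(4)
  unfolding minimal_regular_lin_rep_def minimal_series_lin_rep_def by blast

end
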